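(* Let $k\ge 1$ and let $S_1,\ldots,S_k$ be nonempty finite strings of positive integers such that no $S_i$ occurs as a substring (consecutive block) of any $S_j$ with $j\neq i$. Let $$G(x,q)=\sum_{\sigma} x^{w(\sigma)}q^{\ell(\sigma)},$$ where the sum runs over all compositions $\sigma$ (including the empty composition, which contributes $1$) with parts in $\mathbb{N}=\{1,2,3,\ldots\}$ that contain none of $S_1,\ldots,S_k$ as a substring. Then $$G(x,q)=\frac{(1-x)\cdot\det\big(-c_{ij}(x,q)\big)_{1\le i,j\le k}}{\det M},$$ where $M$ is the $(k+1)\times(k+1)$ matrix whose first row is $\big(1-x(1+q),\,1-x,\,1-x,\,\ldots,\,1-x\big)$ and whose row $i+1$ (for $i=1,\ldots,k$) is $\big(x^{w(S_i)}q^{\ell(S_i)},\,-c_{i1}(x,q),\,\ldots,\,-c_{ik}(x,q)\big)$.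
   Context: A composition $\sigma=\sigma_1\cdots\sigma_m$ is a finite string of positive integers; its weight is $w(\sigma)=\sigma_1+\cdots+\sigma_m$ and its length (number of parts) is $\ell(\sigma)=m$. The same notation $w$, $\ell$ is used for any finite string of positive integers. A string $s_1\cdots s_m$ contains the substring $b_1\cdots b_r$ if there is $i$ with $s_is_{i+1}\cdots s_{i+r-1}=b_1\cdots b_r$; otherwise it avoids it. Correlation: for strings $S_i=a_0a_1\cdots a_{m-1}$ and $S_j=b_0b_1\cdots b_{\ell-1}$, the correlation is the binary string $c_0c_1\cdots c_{m-1}$ defined by: if $m\le \ell$, for $0\le t\le m-1$, $c_t=1$ iff $a_r=b_{\ell-m+r+t}$ for all $r=0,\ldots,m-t-1$, and $c_t=0$ otherwise; if $m>\ell$, for $0\le t\le m-\ell$, $c_t=1$ iff $b_r=a_{m-\ell+r-t}$ for all $r=0,\ldots,\ell-1$, and for $m-\ell+1\le t\le m-1$, $c_t=1$ iff $a_r=b_{\ell-m+r+t}$ for all $r=0,\ldots,m-t-1$; $c_t=0$ otherwise. The correlation polynomial is $$c_{ij}(x,q)=c_0+c_1x^{a_{m-1}}q+c_2x^{a_{m-2}+a_{m-1}}q^2+\cdots+c_{m-1}x^{a_1+a_2+\cdots+a_{m-1}}q^{m-1},$$ i.e. the term for $t$ is $c_t\,x^{a_{m-t}+\cdots+a_{m-1}}q^t$. *)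

theory Defs
  imports
    "HOL-Library.Sublist"
    "HOL-Computational_Algebra.Formal_Power_Series"
    "HOL-Computational_Algebra.Polynomial_FPS"
    "Jordan_Normal_Form.Determinant"
begin

text \<open>
  Compositions are lists of positive natural numbers.  Bivariate generating functions live in
  \<open>\<int>[q][[x]]\<close>, the type \<^typ>\<open>int poly fps\<close>: the series variable is \<open>x\<close> and
  the coefficients are polynomials in \<open>q\<close>.  Since a positive integer has only finitely many
  compositions, the generating functions below do lie in this subring of \<open>\<int>[[x,q]]\<close>.
\<close>

definition pos_string :: "nat list \<Rightarrow> bool" where
  "pos_string s \<longleftrightarrow> (\<forall>p\<in>set s. 1 \<le> p)"

definition avoids :: "nat list set \<Rightarrow> nat list \<Rightarrow> bool" where
  "avoids F s \<longleftrightarrow> (\<forall>b\<in>F. \<not> sublist b s)"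

abbreviation X :: "int poly fps" where
  "X \<equiv> fps_X"

abbreviation Q :: "int poly fps" where
  "Q \<equiv> fps_const [:0, 1:]"

definition avoiding_compositions :: "nat list set \<Rightarrow> nat \<Rightarrow> nat list set" where
  "avoiding_compositions F n = {s. pos_string s \<and> avoids F s \<and> sum_list s = n}"

definition avoid_gf :: "nat list set \<Rightarrow> int poly fps" where
  "avoid_gf F = Abs_fps (\<lambda>n. \<Sum>s\<in>avoiding_compositions F n. [:0, 1:] ^ length s)"

text \<open>
  The sum in \<^const>\<open>avoid_gf\<close> is finite, and the coefficient of \<open>x\<^sup>n q\<^sup>m\<close> counts the
  avoiding compositions of weight \<open>n\<close> and length \<open>m\<close>.
\<close>

lemma length_le_sum_list_pos: "pos_string s \<Longrightarrow> length s \<le> sum_list s"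
  by (induction s) (auto simp: pos_string_def)

lemma finite_avoiding_compositions: "finite (avoiding_compositions F n)"
proof (rule finite_subset)
  show "avoiding_compositions F n \<subseteq> {s. set s \<subseteq> {..n} \<and> length s \<le> n}"
    using length_le_sum_list_pos member_le_sum_list
    by (fastforce simp: avoiding_compositions_def)
  show "finite {s. set s \<subseteq> {..n} \<and> length s \<le> n}"
    by (rule finite_lists_length_le) simp
qed

lemma coeff_avoid_gf:
  "poly.coeff (fps_nth (avoid_gf F) n) m =
     int (card {s. pos_string s \<and> avoids F s \<and> sum_list s = n \<and> length s = m})"
proof -
  have "poly.coeff (fps_nth (avoid_gf F) n) m =
      (\<Sum>s\<in>avoiding_compositions F n. if length s = m then 1 else 0)"
    by (simp add: avoid_gf_def coeff_sum monom_altdef[of 1, simplified, symmetric])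
  also have "\<dots> = int (card {s \<in> avoiding_compositions F n. length s = m})"
    using finite_avoiding_compositions[of F n] by (simp flip: sum.inter_filter)
  also have "{s \<in> avoiding_compositions F n. length s = m} =
      {s. pos_string s \<and> avoids F s \<and> sum_list s = n \<and> length s = m}"
    by (auto simp: avoiding_compositions_def)
  finally show ?thesis .
qed

text \<open>
  In the correlation of \<open>a\<close> and \<open>b\<close>, indices of the form \<open>l - m + r + t\<close> and
  \<open>m - l + r - t\<close> are rearranged so that no intermediate difference on \<^typ>\<open>nat\<close> is
  truncated.
\<close>

definition correlation :: "nat list \<Rightarrow> nat list \<Rightarrow> bool list" where
  "correlation a b = (let m = length a; l = length b in
     map (\<lambda>t. if m > l \<and> t \<le> m - l
              then \<forall>r<l. b ! r = a ! (m + r - (l + t))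
              else \<forall>r<m - t. a ! r = b ! (l + r + t - m))
       [0..<m])"

definition corr_poly :: "nat list \<Rightarrow> nat list \<Rightarrow> int poly fps" where
  "corr_poly a b = (\<Sum>t<length a. of_bool (correlation a b ! t)
     * X ^ (\<Sum>r\<in>{length a - t..<length a}. a ! r) * Q ^ t)"

definition corr_matrix :: "nat \<Rightarrow> (nat \<Rightarrow> nat list) \<Rightarrow> int poly fps mat" where
  "corr_matrix k S = mat k k (\<lambda>(i, j). - corr_poly (S (i + 1)) (S (j + 1)))"

text \<open>
  Matrices are indexed from \<open>0\<close> and the strings from \<open>1\<close>, so row and column \<open>i \<ge> 1\<close>
  of the bordered matrix belong to \<open>S i\<close>.
\<close>

definition bordered_matrix :: "nat \<Rightarrow> (nat \<Rightarrow> nat list) \<Rightarrow> int poly fps mat" where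
  "bordered_matrix k S = mat (k + 1) (k + 1) (\<lambda>(i, j).
     if i = 0 then (if j = 0 then 1 - X * (1 + Q) else 1 - X)
     else (if j = 0 then X ^ sum_list (S i) * Q ^ length (S i) else - corr_poly (S i) (S j)))"

end

theory Submission
  imports Defs
begin

text \<open>
  Let \<open>T\<^sub>j\<close> enumerate the words that end in \<open>S\<^sub>j\<close> and contain no other occurrence of a
  forbidden string.  Appending a letter to an avoiding word yields a nonempty avoiding word or an
  element of exactly one \<open>T\<^sub>j\<close>, so \<open>G + \<Sum>\<^sub>j T\<^sub>j = 1 + G x q / (1 - x)\<close>.  Appending \<open>S\<^sub>i\<close> to an
  avoiding word and cutting the result at the end of the first occurrence of a forbidden string
  leaves an element of some \<open>T\<^sub>j\<close> and a proper final segment of \<open>S\<^sub>i\<close> recorded by the correlation,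
  so \<open>G x\<^bsup>w(S\<^sub>i)\<^esup> q\<^bsup>\<ell>(S\<^sub>i)\<^esup> = \<Sum>\<^sub>j c\<^sub>i\<^sub>j T\<^sub>j\<close>.  The bordered matrix is the matrix of this linear system,
  and Cramer's rule gives \<open>G\<close>.  At \<open>x = 0\<close> the matrix \<open>(c\<^sub>i\<^sub>j)\<close> becomes the
  identity, so the right-hand side of \<open>G det M = (1 - x) det (-c\<^sub>i\<^sub>j)\<close> and hence \<open>det M\<close> are nonzero.
\<close>

subsection \<open>Generating functions of sets of compositions\<close>

text \<open>Positivity is imposed here and not on \<open>A\<close>, so every set of lists has a
  generating function: each weight leaves only finitely many members.\<close>

definition comps :: "nat list set \<Rightarrow> nat \<Rightarrow> nat list set" where
  "comps A n = {s \<in> A. pos_string s \<and> sum_list s = n}"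

definition gen_fun :: "nat list set \<Rightarrow> int poly fps" where
  "gen_fun A = Abs_fps (\<lambda>n. \<Sum>s\<in>comps A n. [:0, 1:] ^ length s)"

lemma finite_comps [simp]: "finite (comps A n)"
  by (rule finite_subset[OF _ finite_avoiding_compositions[of "{}" n]])
     (auto simp: comps_def avoiding_compositions_def avoids_def)

lemma avoid_gf_conv_gen_fun: "avoid_gf F = gen_fun {s. avoids F s}"
  unfolding avoid_gf_def gen_fun_def
  by (simp add: comps_def avoiding_compositions_def conj_left_commute)

lemma pos_string_append [simp]: "pos_string (u @ v) \<longleftrightarrow> pos_string u \<and> pos_string v"
  by (auto simp: pos_string_def)

lemma gen_fun_UN:
  assumes "finite I" "\<And>i j. i \<in> I \<Longrightarrow> j \<in> I \<Longrightarrow> i \<noteq> j \<Longrightarrow> A i \<inter> A j = {}"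
  shows "gen_fun (\<Union>i\<in>I. A i) = (\<Sum>i\<in>I. gen_fun (A i))"
proof (rule fps_ext)
  fix n
  have "comps (\<Union>i\<in>I. A i) n = (\<Union>i\<in>I. comps (A i) n)"
    by (auto simp: comps_def)
  moreover have "\<forall>i\<in>I. \<forall>j\<in>I. i \<noteq> j \<longrightarrow> comps (A i) n \<inter> comps (A j) n = {}"
    using assms(2) by (auto simp: comps_def)
  ultimately show "fps_nth (gen_fun (\<Union>i\<in>I. A i)) n = fps_nth (\<Sum>i\<in>I. gen_fun (A i)) n"
    using assms(1) by (simp add: gen_fun_def fps_sum_nth sum.UNION_disjoint)
qed

lemma gen_fun_Un:
  assumes "A \<inter> B = {}"
  shows "gen_fun (A \<union> B) = gen_fun A + gen_fun B"
proof -
  have "comps (A \<union> B) n = comps A n \<union> comps B n" "comps A n \<inter> comps B n = {}" for n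
    using assms by (auto simp: comps_def)
  then show ?thesis
    by (intro fps_ext) (simp add: gen_fun_def sum.union_disjoint)
qed

text \<open>Injectivity means unique factorization, so distributing the weight over the two factors
  gives the Cauchy product.\<close>

lemma gen_fun_append:
  assumes "inj_on (\<lambda>(u, v). u @ v) (A \<times> B)"
  shows "gen_fun ((\<lambda>(u, v). u @ v) ` (A \<times> B)) = gen_fun A * gen_fun B"
proof (rule fps_ext)
  fix n
  let ?app = "\<lambda>(u, v). u @ v" and ?q = "[:0, 1:] :: int poly"
  let ?P = "\<Union>i\<in>{0..n}. comps A i \<times> comps B (n - i)"
  have img: "comps (?app ` (A \<times> B)) n = ?app ` ?P"
  proof (intro equalityI subsetI)
    fix s assume "s \<in> comps (?app ` (A \<times> B)) n"
    then obtain u v where uv: "s = u @ v" "u \<in> A" "v \<in> B" "pos_string u" "pos_string v"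
      "sum_list u + sum_list v = n"
      by (auto simp: comps_def)
    then have "(u, v) \<in> comps A (sum_list u) \<times> comps B (n - sum_list u)" "sum_list u \<in> {0..n}"
      by (auto simp: comps_def)
    then have "(u, v) \<in> ?P" by blast
    then show "s \<in> ?app ` ?P" using uv(1) by force
  qed (force simp: comps_def)
  have inj: "inj_on ?app ?P"
    by (rule inj_on_subset[OF assms]) (auto simp: comps_def)
  have "fps_nth (gen_fun (?app ` (A \<times> B))) n = (\<Sum>p\<in>?P. ?q ^ length (?app p))"
    by (simp add: gen_fun_def img sum.reindex[OF inj])
  also have "\<dots> = (\<Sum>i=0..n. \<Sum>p\<in>comps A i \<times> comps B (n - i). ?q ^ length (?app p))"
    by (rule sum.UNION_disjoint) (simp, simp, auto simp: comps_def)
  also have "\<dots> = (\<Sum>i=0..n. fps_nth (gen_fun A) i * fps_nth (gen_fun B) (n - i))"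
    by (simp add: gen_fun_def sum_product sum.cartesian_product power_add case_prod_unfold)
  finally show "fps_nth (gen_fun (?app ` (A \<times> B))) n = fps_nth (gen_fun A * gen_fun B) n"
    by (simp add: fps_mult_nth)
qed

lemma gen_fun_singleton:
  assumes "pos_string s"
  shows "gen_fun {s} = X ^ sum_list s * Q ^ length s"
proof -
  have "comps {s} n = (if n = sum_list s then {s} else {})" for n
    using assms by (auto simp: comps_def)
  then show ?thesis
    by (intro fps_ext) (simp add: gen_fun_def fps_X_power_mult_nth)
qed

lemma gen_fun_append_const:
  assumes "pos_string s"
  shows "gen_fun ((\<lambda>u. u @ s) ` A) = gen_fun A * (X ^ sum_list s * Q ^ length s)"
proof -
  have "(\<lambda>u. u @ s) ` A = (\<lambda>(u, v). u @ v) ` (A \<times> {s})" by auto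
  moreover have "inj_on (\<lambda>(u, v). u @ v) (A \<times> {s})" by (auto simp: inj_on_def)
  ultimately show ?thesis
    using gen_fun_append[of A "{s}"] gen_fun_singleton[OF assms] by simp
qed

text \<open>The geometric series \<open>X * Q / (1 - X)\<close> with its denominator cleared; the
  letter \<open>0\<close> in the range is discarded by \<open>comps\<close>.\<close>

lemma gen_fun_letters: "(1 - X) * gen_fun (range (\<lambda>p. [p])) = X * Q"
proof -
  have "comps (range (\<lambda>p. [p])) n = (if n = 0 then {} else {[n]})" for n
    by (auto simp: comps_def pos_string_def)
  then have "fps_nth (gen_fun (range (\<lambda>p. [p]))) n = (if n = 0 then 0 else [:0, 1:])" for n
    by (simp add: gen_fun_def)
  then show ?thesis
    by (intro fps_ext) (auto simp: left_diff_distrib)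
qed

section \<open>Pointwise form of correlations and of suffixes\<close>

lemma correlation_nth:
  assumes "t < length a"
  shows "correlation a b ! t \<longleftrightarrow>
    (if length a > length b \<and> t \<le> length a - length b
     then \<forall>r<length b. b ! r = a ! (length a + r - (length b + t))
     else \<forall>r<length a - t. a ! r = b ! (length b + r + t - length a))"
  using assms by (simp add: correlation_def Let_def)

lemma suffix_iff_drop:
  "suffix xs ys \<longleftrightarrow> length xs \<le> length ys \<and> drop (length ys - length xs) ys = xs"
proof
  assume "length xs \<le> length ys \<and> drop (length ys - length xs) ys = xs"
  then show "suffix xs ys" using suffix_drop[of "length ys - length xs" ys] by simp
qed (auto simp: suffix_def)

subsection \<open>Reduced families of strings\<close>

locale reduced_strings =
  fixes S :: "'i \<Rightarrow> nat list" and I :: "'i set"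
  assumes finite_index: "finite I"
    and nonempty: "i \<in> I \<Longrightarrow> S i \<noteq> []"
    and positive: "i \<in> I \<Longrightarrow> pos_string (S i)"
    and reduced: "i \<in> I \<Longrightarrow> j \<in> I \<Longrightarrow> sublist (S i) (S j) \<Longrightarrow> i = j"
begin

definition avoiding :: "nat list set" where
  "avoiding = {s. avoids (S ` I) s}"

text \<open>The words counted by \<open>T\<^sub>j\<close>: every proper prefix avoids the family, so
  the final \<open>S j\<close> completes the first forbidden occurrence.\<close>

definition first_hits :: "'i \<Rightarrow> nat list set" where
  "first_hits j = {s. s \<noteq> [] \<and> butlast s \<in> avoiding \<and> suffix (S j) s}"

lemma avoiding_iff: "s \<in> avoiding \<longleftrightarrow> (\<forall>i\<in>I. \<not> sublist (S i) s)"
  by (auto simp: avoiding_def avoids_def)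

lemma Nil_avoiding: "[] \<in> avoiding"
  using nonempty by (auto simp: avoiding_iff)

lemma avoiding_sublist: "s \<in> avoiding \<Longrightarrow> sublist u s \<Longrightarrow> u \<in> avoiding"
  unfolding avoiding_iff using sublist_order.order.trans by blast

lemma first_hits_not_avoiding: "j \<in> I \<Longrightarrow> s \<in> first_hits j \<Longrightarrow> s \<notin> avoiding"
  by (auto simp: first_hits_def avoiding_iff)

text \<open>Two suffixes of one word are comparable, so one forbidden string would contain the
  other.\<close>

lemma first_hits_disjoint:
  assumes "i \<in> I" "j \<in> I" "s \<in> first_hits i" "s \<in> first_hits j"
  shows "i = j"
proof -
  have "suffix (S i) (S j) \<or> suffix (S j) (S i)"
    using assms(3,4) suffix_same_cases[of "S i" s "S j"] by (simp add: first_hits_def)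
  then show ?thesis
    using reduced[of i j] reduced[of j i] assms(1,2) suffix_imp_sublist by metis
qed

text \<open>A forbidden occurrence created by the last letter must end at that letter.\<close>

lemma snoc_avoiding:
  assumes "v \<in> avoiding"
  shows "v @ [p] \<in> avoiding \<or> (\<exists>j\<in>I. v @ [p] \<in> first_hits j)"
  using assms unfolding avoiding_iff first_hits_def by (auto simp: sublist_snoc avoiding_iff)

text \<open>Here \<open>t\<close> counts the letters of \<open>w\<close> left over after the hit,
  which matches the index of the correlation.\<close>

lemma first_hit_prefix_exists:
  assumes "v \<in> avoiding" "v @ w \<notin> avoiding"
  shows "\<exists>t<length w. \<exists>j\<in>I. v @ take (length w - t) w \<in> first_hits j"
  using assms(2)
proof (induction w rule: rev_induct)
  case Nil
  then show ?case using assms(1) by simp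
next
  case (snoc p w)
  show ?case
  proof (cases "v @ w \<in> avoiding")
    case True
    with snoc_avoiding[OF True, of p] snoc.prems show ?thesis
      by (intro exI[of _ 0]) auto
  next
    case False
    from snoc.IH[OF this] obtain t j where
      "t < length w" "j \<in> I" "v @ take (length w - t) w \<in> first_hits j" by blast
    \<comment> \<open>The hit lies inside \<open>v @ w\<close>, so \<open>p\<close> is one more
      leftover letter.\<close>
    then show ?thesis by (intro exI[of _ "Suc t"]) auto
  qed
qed

text \<open>A word determines where its first forbidden occurrence ends: the shorter of two
  different hits would be a prefix of the \<open>butlast\<close> of the longer one, hence
  avoiding.\<close>

lemma first_hits_cancel:
  assumes "j \<in> I" "j' \<in> I" "u \<in> first_hits j" "u' \<in> first_hits j'" "u @ w = u' @ w'"
  shows "u = u'"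
proof -
  have "\<not> length x < length y"
    if "i \<in> I" "x \<in> first_hits i" "y \<in> first_hits i'" "x @ z = y @ z'" for i i' x y z z'
  proof
    assume less: "length x < length y"
    then have "y = x @ drop (length x) y"
      using that(4) by (metis append_eq_append_conv_if append_take_drop_id less_imp_le_nat)
    moreover from less have "drop (length x) y \<noteq> []" by simp
    ultimately obtain a b where "y = x @ a @ [b]"
      by (metis rev_exhaust)
    then have "sublist x (butlast y)"
      by (simp add: butlast_append)
    moreover have "butlast y \<in> avoiding" using that(3) by (simp add: first_hits_def)
    ultimately have "x \<in> avoiding" by (rule avoiding_sublist[rotated])
    then show False using first_hits_not_avoiding[OF that(1,2)] by contradiction
  qed
  from this[OF assms(1,3,4,5)] this[OF assms(2,4,3) assms(5)[symmetric]]
  have "length u = length u'" by simp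
  then show ?thesis using assms(5) by simp
qed

text \<open>Reducedness collapses the two cases of the definition into one. In the case of full
  containment both sides are false, since either would put the shorter \<open>S j\<close> inside
  \<open>S i\<close>.\<close>

lemma correlation_iff:
  assumes "i \<in> I" "j \<in> I" "t < length (S i)"
  shows "correlation (S i) (S j) ! t \<longleftrightarrow> suffix (take (length (S i) - t) (S i)) (S j)"
proof -
  let ?a = "S i" and ?b = "S j"
  define m where "m = length ?a"
  define l where "l = length ?b"
  show ?thesis
  proof (cases "m > l \<and> t \<le> m - l")
    case True
    then have "?a \<noteq> ?b" by (auto simp: m_def l_def)
    then have not_sub: "\<not> sublist ?b ?a"
      using reduced[OF assms(2,1)] by auto
    have "\<not> (\<forall>r<l. ?b ! r = ?a ! (m + r - (l + t)))"
    proof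
      assume *: "\<forall>r<l. ?b ! r = ?a ! (m + r - (l + t))"
      have "?b = take l (drop (m - l - t) ?a)"
        using True * by (intro nth_equalityI) (auto simp: m_def l_def)
      then show False
        using not_sub by (metis sublist_drop sublist_order.order.trans sublist_take)
    qed
    moreover have "\<not> suffix (take (m - t) ?a) ?b"
    proof
      assume suf: "suffix (take (m - t) ?a) ?b"
      then have "m - t \<le> l"
        using suffix_length_le[OF suf] by (simp add: m_def l_def)
      then have "length (take (m - t) ?a) = length ?b"
        using True by (auto simp: m_def l_def)
      then have "take (m - t) ?a = ?b"
        using suf by (auto simp: suffix_def)
      then show False using not_sub by (metis sublist_take)
    qed
    ultimately show ?thesis
      using True assms(3) by (simp add: correlation_def Let_def m_def l_def)
  next
    case False
    then have le: "m - t \<le> l" by auto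
    have "(\<forall>r<m - t. ?a ! r = ?b ! (l + r + t - m)) \<longleftrightarrow> take (m - t) ?a = drop (l - (m - t)) ?b"
      using le assms(3) by (auto simp: list_eq_iff_nth_eq m_def l_def algebra_simps)
    also have "\<dots> \<longleftrightarrow> suffix (take (m - t) ?a) ?b"
      using suffix_iff_drop[of "take (m - t) ?a" ?b] le by (auto simp: m_def l_def)
    finally show ?thesis
      unfolding correlation_nth[OF assms(3)] m_def[symmetric] l_def[symmetric] if_not_P[OF False] .
  qed
qed

text \<open>A pair \<open>(j, t)\<close> records that the first hit is an \<open>S j\<close> ending
  \<open>t\<close> letters before the end of an appended \<open>S i\<close>.\<close>

definition overlaps :: "'i \<Rightarrow> ('i \<times> nat) set" where
  "overlaps i = {(j, t). j \<in> I \<and> t < length (S i) \<and> correlation (S i) (S j) ! t}"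

text \<open>Cut after the first hit. It ends both in \<open>S j\<close> and in the part of
  \<open>S i\<close> already read, and reducedness makes that part a suffix of \<open>S j\<close>.
  Conversely, an overlap lets the same part be removed from the hit.\<close>

lemma append_string_decomp:
  assumes i: "i \<in> I"
  shows "(\<lambda>v. v @ S i) ` avoiding =
    (\<Union>(j, t)\<in>overlaps i. (\<lambda>u. u @ drop (length (S i) - t) (S i)) ` first_hits j)"
    (is "?L = ?R")
proof (intro equalityI subsetI)
  let ?a = "S i" and ?m = "length (S i)"
  fix s assume "s \<in> ?L"
  then obtain v where v: "v \<in> avoiding" "s = v @ ?a" by blast
  have "v @ ?a \<notin> avoiding" using i by (auto simp: avoiding_iff)
  then obtain t j where tj: "t < ?m" "j \<in> I" and hit: "v @ take (?m - t) ?a \<in> first_hits j"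
    using first_hit_prefix_exists[OF v(1)] by blast
  let ?c = "take (?m - t) ?a"
  have "suffix ?c (v @ ?c)" by (rule suffixI) simp
  moreover have "suffix (S j) (v @ ?c)" using hit by (simp add: first_hits_def)
  ultimately have "suffix ?c (S j) \<or> suffix (S j) ?c"
    by (rule suffix_same_cases)
  \<comment> \<open>In the other order \<open>S j\<close> would lie inside \<open>S i\<close>, which
    forces \<open>j = i\<close> and equality of the two suffixes.\<close>
  moreover have "suffix ?c (S j)" if "suffix (S j) ?c"
  proof -
    have "sublist (S j) ?a"
      using that by (meson sublist_order.order.trans sublist_take suffix_imp_sublist)
    then have "j = i" using reduced i tj(2) by blast
    then have "?c = S j" using suffix_length_le[OF that] by simp
    then show ?thesis by simp
  qed
  ultimately have "suffix ?c (S j)" by blast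
  then have "(j, t) \<in> overlaps i"
    using tj correlation_iff[OF i tj(2,1)] by (simp add: overlaps_def)
  moreover have "s = (v @ ?c) @ drop (?m - t) ?a" by (simp add: v)
  ultimately show "s \<in> ?R" using hit by blast
next
  let ?a = "S i" and ?m = "length (S i)"
  fix s assume "s \<in> ?R"
  then obtain j t u where jt: "j \<in> I" "t < ?m" "correlation ?a (S j) ! t"
    and u: "u \<in> first_hits j" "s = u @ drop (?m - t) ?a"
    by (auto simp: overlaps_def)
  have "suffix (take (?m - t) ?a) u"
    using jt u(1) correlation_iff[OF i jt(1,2)] suffix_order.dual_order.trans
    by (auto simp: first_hits_def)
  then obtain v where v: "u = v @ take (?m - t) ?a" by (auto simp: suffix_def)
  \<comment> \<open>At least one letter is removed, so \<open>v\<close> is a prefix of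
    \<open>butlast u\<close> and inherits avoidance.\<close>
  have "take (?m - t) ?a \<noteq> []" using jt(2) by auto
  then have "butlast u = v @ butlast (take (?m - t) ?a)" by (simp add: v butlast_append)
  then have "sublist v (butlast u)" by simp
  moreover have "butlast u \<in> avoiding" using u(1) by (simp add: first_hits_def)
  ultimately have "v \<in> avoiding" by (rule avoiding_sublist[rotated])
  then show "s \<in> ?L" using u(2) v by auto
qed

subsection \<open>The linear system\<close>

lemma avoiding_Un_first_hits:
  "avoiding \<union> (\<Union>j\<in>I. first_hits j) =
    {[]} \<union> (\<lambda>(u, v). u @ v) ` (avoiding \<times> range (\<lambda>p. [p]))"
    (is "?L = ?R")
proof (intro equalityI subsetI)
  fix s assume s: "s \<in> ?L"
  show "s \<in> ?R"
  proof (cases s rule: rev_cases)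
    case (snoc v p)
    then have "v \<in> avoiding"
      using s avoiding_sublist[of s v] by (auto simp: first_hits_def)
    then show ?thesis using snoc by force
  qed simp
next
  fix s assume "s \<in> ?R"
  then show "s \<in> ?L"
    using Nil_avoiding snoc_avoiding by auto
qed

text \<open>Row \<open>0\<close> of the system, multiplied by \<open>1 - X\<close> to clear the
  denominator of the letter series.\<close>

lemma letter_equation:
  "(1 - X * (1 + Q)) * gen_fun avoiding + (1 - X) * (\<Sum>j\<in>I. gen_fun (first_hits j)) = 1 - X"
proof -
  let ?G = "gen_fun avoiding" and ?P = "gen_fun (range (\<lambda>p. [p]))"
  let ?W = "(\<lambda>(u, v). u @ v) ` (avoiding \<times> range (\<lambda>p. [p]))"
  have "?G + (\<Sum>j\<in>I. gen_fun (first_hits j)) = gen_fun (avoiding \<union> (\<Union>j\<in>I. first_hits j))"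
    using first_hits_disjoint first_hits_not_avoiding finite_index
    by (subst gen_fun_Un, blast, subst gen_fun_UN) auto
  also have "\<dots> = gen_fun {[]} + gen_fun ?W"
    unfolding avoiding_Un_first_hits by (rule gen_fun_Un) auto
  also have "gen_fun {[]} = 1"
    using gen_fun_singleton[of "[]"] by (simp add: pos_string_def)
  also have "gen_fun ?W = ?G * ?P"
    by (rule gen_fun_append) (auto simp: inj_on_def)
  finally have "(1 - X) * (?G + (\<Sum>j\<in>I. gen_fun (first_hits j))) =
      (1 - X) + ?G * ((1 - X) * ?P)"
    by (simp add: algebra_simps)
  then show ?thesis
    unfolding gen_fun_letters by (simp add: algebra_simps)
qed

text \<open>The row of \<open>S i\<close>: the leftover of length \<open>t\<close> contributes
  exactly the monomial of the \<open>t\<close>-th term of the correlation polynomial.\<close>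

lemma correlation_equation:
  assumes i: "i \<in> I"
  shows "X ^ sum_list (S i) * Q ^ length (S i) * gen_fun avoiding =
    (\<Sum>j\<in>I. corr_poly (S i) (S j) * gen_fun (first_hits j))"
proof -
  let ?a = "S i" and ?m = "length (S i)"
  let ?tail = "\<lambda>t. drop (?m - t) ?a"
  let ?W = "\<lambda>(j, t). (\<lambda>u. u @ ?tail t) ` first_hits j"
  let ?w = "\<lambda>t. X ^ (\<Sum>r\<in>{?m - t..<?m}. ?a ! r) * Q ^ t"
  have pos: "pos_string (?tail t)" for t
    using positive[OF i] by (auto simp: pos_string_def dest: in_set_dropD)
  have fin: "finite (overlaps i)"
    by (rule finite_subset[of _ "I \<times> {..<?m}"]) (auto simp: overlaps_def finite_index)
  \<comment> \<open>Cancellation gives equal hits, hence tails of equal length and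
    \<open>t = t'\<close>; disjointness of the hit sets then gives \<open>j = j'\<close>.\<close>
  have disj: "?W p \<inter> ?W p' = {}" if "p \<in> overlaps i" "p' \<in> overlaps i" "p \<noteq> p'" for p p'
  proof (rule ccontr)
    assume "?W p \<inter> ?W p' \<noteq> {}"
    moreover obtain j t j' t' where p: "p = (j, t)" "p' = (j', t')" by (cases p, cases p') auto
    ultimately obtain u u' where u: "u \<in> first_hits j" "u' \<in> first_hits j'"
      "u @ ?tail t = u' @ ?tail t'" by auto
    have jt: "j \<in> I" "t < ?m" "j' \<in> I" "t' < ?m"
      using that p by (auto simp: overlaps_def)
    have "u = u'" by (rule first_hits_cancel[OF jt(1,3) u])
    moreover from this u(3) have "length (?tail t) = length (?tail t')" by simp
    ultimately show False
      using first_hits_disjoint[OF jt(1,3) u(1)] u(2) that(3) p jt by auto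
  qed
  have tail_weight: "sum_list (?tail t) = (\<Sum>r\<in>{?m - t..<?m}. ?a ! r)" if "t < ?m" for t
  proof -
    have "?tail t = map ((!) ?a) [?m - t..<?m]"
      using that by (intro nth_equalityI) auto
    then show ?thesis by (simp add: sum_list_distinct_conv_sum_set)
  qed
  have "X ^ sum_list ?a * Q ^ ?m * gen_fun avoiding = gen_fun ((\<lambda>v. v @ ?a) ` avoiding)"
    by (simp add: gen_fun_append_const[OF positive[OF i]] mult.commute)
  also have "\<dots> = (\<Sum>p\<in>overlaps i. gen_fun (?W p))"
    unfolding append_string_decomp[OF i] by (rule gen_fun_UN[OF fin disj])
  also have "\<dots> = (\<Sum>(j, t)\<in>overlaps i. ?w t * gen_fun (first_hits j))"
    by (intro sum.cong)
       (auto simp: overlaps_def gen_fun_append_const[OF pos] tail_weight mult.commute)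
  also have "\<dots> = (\<Sum>(j, t)\<in>I \<times> {..<?m}.
      of_bool (correlation ?a (S j) ! t) * ?w t * gen_fun (first_hits j))"
    by (rule sum.mono_neutral_cong_left) (auto simp: overlaps_def finite_index)
  also have "\<dots> = (\<Sum>j\<in>I. corr_poly ?a (S j) * gen_fun (first_hits j))"
    by (simp only: corr_poly_def sum_distrib_right sum.cartesian_product mult.assoc)
  finally show ?thesis .
qed

text \<open>This makes the correlation matrix the identity at \<open>x = 0\<close>. For
  \<open>t > 0\<close> the exponent of \<open>X\<close> is positive, and at \<open>t = 0\<close> the
  correlation asks whether \<open>S i\<close> is a suffix of \<open>S j\<close>.\<close>

lemma corr_poly_nth_0:
  assumes "i \<in> I" "j \<in> I"
  shows "fps_nth (corr_poly (S i) (S j)) 0 = of_bool (i = j)"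
proof -
  let ?a = "S i" and ?m = "length (S i)"
  define e where "e = (\<lambda>t. \<Sum>r\<in>{?m - t..<?m}. ?a ! r)"
  have e_pos: "0 < e t" if "0 < t" "t < ?m" for t
    unfolding e_def
  proof (rule sum_pos2)
    show "?m - 1 \<in> {?m - t..<?m}" using that by auto
    have "?a ! (?m - 1) \<in> set ?a" using that by (intro nth_mem) simp
    then show "0 < ?a ! (?m - 1)"
      using positive[OF assms(1)] by (fastforce simp: pos_string_def)
  qed auto
  have nth_0: "fps_nth (of_bool (correlation ?a (S j) ! t) * X ^ e t * Q ^ t) 0 =
      (if t = 0 then of_bool (correlation ?a (S j) ! 0) else 0)" if "t < ?m" for t
  proof (cases "t = 0")
    case True
    then show ?thesis by (simp add: e_def)
  next
    case False
    then show ?thesis using e_pos[OF _ that] by (simp add: zero_power)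
  qed
  have "fps_nth (corr_poly ?a (S j)) 0 =
      (\<Sum>t<?m. fps_nth (of_bool (correlation ?a (S j) ! t) * X ^ e t * Q ^ t) 0)"
    by (simp only: corr_poly_def fps_sum_nth e_def)
  also have "\<dots> = (\<Sum>t<?m. if t = 0 then of_bool (correlation ?a (S j) ! 0) else 0)"
    by (rule sum.cong[OF refl nth_0]) simp
  also have "\<dots> = of_bool (correlation ?a (S j) ! 0)"
    using nonempty[OF assms(1)] by simp
  also have "correlation ?a (S j) ! 0 \<longleftrightarrow> i = j"
    using correlation_iff[OF assms, of 0] nonempty[OF assms(1)] reduced[OF assms] by auto
  finally show ?thesis by simp
qed

end

section \<open>Solving the system by Cramer's rule\<close>

lemma comm_ring_hom_fps_nth_0: "comm_ring_hom (\<lambda>f :: 'a :: comm_ring_1 fps. fps_nth f 0)"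
  by unfold_locales simp_all

theorem theorem2:
  fixes k :: nat and S :: "nat \<Rightarrow> nat list"
  assumes "1 \<le> k"
    and "\<And>i. i \<in> {1..k} \<Longrightarrow> S i \<noteq> [] \<and> pos_string (S i)"
    and "\<And>i j. i \<in> {1..k} \<Longrightarrow> j \<in> {1..k} \<Longrightarrow> j \<noteq> i \<Longrightarrow> \<not> sublist (S i) (S j)"
  shows "det (bordered_matrix k S) \<noteq> 0 \<and>
    to_fract (avoid_gf (S ` {1..k})) =
      to_fract ((1 - X) * det (corr_matrix k S)) / to_fract (det (bordered_matrix k S))"
proof -
  interpret reduced_strings S "{1..k}"
    by unfold_locales (use assms in auto)
  \<comment> \<open>Evaluation at \<open>x = 0\<close> is a ring homomorphism and so commutes with
    determinants.\<close>
  interpret const: comm_ring_hom "\<lambda>f :: int poly fps. fps_nth f 0"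
    by (rule comm_ring_hom_fps_nth_0)
  let ?G = "gen_fun avoiding" and ?T = "\<lambda>j. gen_fun (first_hits j)"
  let ?B = "bordered_matrix k S" and ?C = "corr_matrix k S"
  \<comment> \<open>The unknowns of the system; replacing column \<open>0\<close> in
    \<open>R\<close> isolates the component \<open>?G\<close>.\<close>
  define x where "x = vec (k + 1) (\<lambda>j. if j = 0 then ?G else ?T j)"
  define R where "R = replace_col ?B (?B *\<^sub>v x) 0"
  have B: "?B \<in> carrier_mat (k + 1) (k + 1)" by (simp add: bordered_matrix_def)
  have x: "x \<in> carrier_vec (k + 1)" by (simp add: x_def)
  have split: "(\<Sum>j = 0..<k + 1. f j) = f 0 + (\<Sum>j\<in>{1..k}. f j)" for f :: "nat \<Rightarrow> int poly fps"
    by (simp add: sum.atLeast_Suc_atMost atLeastLessThanSuc_atLeastAtMost)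
  have "(?B *\<^sub>v x) $ i = (if i = 0 then 1 - X else 0)" if "i < k + 1" for i
  proof -
    have "(?B *\<^sub>v x) $ i = (\<Sum>j = 0..<k + 1. ?B $$ (i, j) * x $ j)"
      using that B x by (simp add: scalar_prod_def)
    also have "\<dots> = ?B $$ (i, 0) * ?G + (\<Sum>j\<in>{1..k}. ?B $$ (i, j) * ?T j)"
      unfolding split by (simp add: x_def)
    also have "\<dots> = (if i = 0 then 1 - X else 0)"
    proof (cases "i = 0")
      case True
      then show ?thesis
        using letter_equation by (simp add: bordered_matrix_def sum_distrib_left)
    next
      case False
      then show ?thesis
        using that correlation_equation[of i] by (simp add: bordered_matrix_def sum_negf)
    qed
    finally show ?thesis .
  qed
  then have col: "R $$ (i, 0) = (if i = 0 then 1 - X else 0)" if "i < k + 1" for i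
    using that B by (simp add: R_def replace_col_def)
  have R: "R \<in> carrier_mat (k + 1) (k + 1)" using B by (simp add: R_def replace_col_def)
  have minor: "mat_delete R 0 0 = ?C"
    by (rule eq_matI) (auto simp: mat_delete_def R_def replace_col_def
        bordered_matrix_def corr_matrix_def)
  \<comment> \<open>The replaced column has \<open>1 - X\<close> on top and zeros below, so one
    cofactor survives.\<close>
  have "det R = (\<Sum>i<k + 1. R $$ (i, 0) * cofactor R i 0)"
    by (rule laplace_expansion_column[OF R]) simp
  also have "\<dots> = (\<Sum>i<k + 1. if i = 0 then (1 - X) * cofactor R 0 0 else 0)"
    by (intro sum.cong) (auto simp: col)
  also have "\<dots> = (1 - X) * det ?C" by (simp add: cofactor_def minor)
  finally have eq: "?G * det ?B = (1 - X) * det ?C"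
    using cramer_lemma_mat[OF B x, of 0] by (simp add: R_def x_def)
  have "fps_nth (det ?C) 0 = det (map_mat (\<lambda>f. fps_nth f 0) ?C)"
    by (rule const.hom_det[symmetric])
  also have "map_mat (\<lambda>f. fps_nth f 0) ?C = (- 1) \<cdot>\<^sub>m 1\<^sub>m k"
    by (rule eq_matI) (auto simp: corr_matrix_def corr_poly_nth_0)
  also have "det \<dots> = (- 1) ^ k" by simp
  finally have "fps_nth ((1 - X) * det ?C) 0 \<noteq> 0" by simp
  then have "?G * det ?B \<noteq> 0" using eq by auto
  then have "det ?B \<noteq> 0" by auto
  moreover have "avoid_gf (S ` {1..k}) = ?G"
    unfolding avoid_gf_conv_gen_fun avoiding_def ..
  ultimately show ?thesis
    \<comment> \<open>The identity \<open>eq\<close> is divided by the nonzero determinant in the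
      fraction field.\<close>
    by (simp only: eq_divide_eq to_fract_eq_0_iff to_fract_eq_iff eq flip: to_fract_mult) simp
qed

end
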